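(* Let $m,n\ge 2$ with $\max\{m,n\}\ge3$ (so that $K_{m,n}$ contains a copy of $K_{2,3}$). The matroid ${\mathcal M}_{f_{1,0}}(K_{m,n})$ is the unique maximal $K_{2,3}$-matroid on $K_{m,n}$ and ${\rm val}_{K_{2,3}}$ is its rank function.
   Context: $f_{1,0}(F)=|V(F)|$ for $F\subseteq E(K_{m,n})$, $V(F)$ the set of vertices incident to $F$; ${\mathcal M}_{f_{1,0}}(K_{m,n})$ is the matroid on $E(K_{m,n})$ whose independent sets are those $F$ with $|I|\le |V(I)|$ for every nonempty $I\subseteq F$. A $K_{2,3}$-matroid on $K_{m,n}$ is a matroid on $E(K_{m,n})$ in which the edge set of every subgraph isomorphic to $K_{2,3}$ is a circuit; maximality is in the weak order (${\mathcal M}_1\preceq{\mathcal M}_2$ if every independent set of ${\mathcal M}_1$ is independent in ${\mathcal M}_2$). With ${\mathcal X}$ the family of edge sets of copies of $K_{2,3}$ in $K_{m,n}$: a proper ${\mathcal X}$-sequence is $(X_1,\dots,X_k)$ in ${\mathcal X}$ with $X_i\not\subseteq\bigcup_{j<i}X_j$ for $i\ge2$; ${\rm val}(F,{\mathcal S})=|F\cup\bigcup_iX_i|-k$; ${\rm val}_{K_{2,3}}(F)=\min_{\mathcal S}{\rm val}(F,{\mathcal S})$. *)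

theory Defs
  imports Main
begin

text \<open>A matroid on a finite ground set is represented by its family of independent sets.\<close>

definition matroid_on :: "'a set \<Rightarrow> 'a set set \<Rightarrow> bool" where
  "matroid_on E M \<longleftrightarrow>
     finite E \<and> M \<subseteq> Pow E \<and> {} \<in> M \<and>
     (\<forall>A\<in>M. \<forall>B. B \<subseteq> A \<longrightarrow> B \<in> M) \<and>
     (\<forall>A\<in>M. \<forall>B\<in>M. card A < card B \<longrightarrow> (\<exists>x\<in>B - A. insert x A \<in> M))"

definition circuit :: "'a set \<Rightarrow> 'a set set \<Rightarrow> 'a set \<Rightarrow> bool" where
  "circuit E M C \<longleftrightarrow> C \<subseteq> E \<and> C \<notin> M \<and> (\<forall>D. D \<subset> C \<longrightarrow> D \<in> M)"

definition matroid_rank :: "'a set set \<Rightarrow> 'a set \<Rightarrow> nat" where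
  "matroid_rank M F = Max {card A | A. A \<subseteq> F \<and> A \<in> M}"

definition weak_le :: "'a set set \<Rightarrow> 'a set set \<Rightarrow> bool" where
  "weak_le M1 M2 \<longleftrightarrow> (\<forall>A. A \<in> M1 \<longrightarrow> A \<in> M2)"

text \<open>Independent sets of the count matroid induced by \<open>f\<close> on \<open>E\<close>.\<close>

definition count_matroid :: "('a set \<Rightarrow> nat) \<Rightarrow> 'a set \<Rightarrow> 'a set set" where
  "count_matroid f E = {F. F \<subseteq> E \<and> (\<forall>I. I \<subseteq> F \<longrightarrow> I \<noteq> {} \<longrightarrow> card I \<le> f I)}"

definition proper_seq :: "'a set set \<Rightarrow> 'a set list \<Rightarrow> bool" where
  "proper_seq X S \<longleftrightarrow> set S \<subseteq> X \<and>
     (\<forall>i. 1 \<le> i \<longrightarrow> i < length S \<longrightarrow> \<not> S ! i \<subseteq> (\<Union>j<i. S ! j))"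

text \<open>The empty sequence is proper, so that \<open>val_min X F \<le> card F\<close>.\<close>

definition val :: "'a set \<Rightarrow> 'a set list \<Rightarrow> int" where
  "val F S = int (card (F \<union> \<Union> (set S))) - int (length S)"

definition val_min :: "'a set set \<Rightarrow> 'a set \<Rightarrow> int" where
  "val_min X F = Min {val F S | S. proper_seq X S}"

text \<open>Edges are two-element sets of vertices; the two sides of \<open>K\<^sub>m\<^sub>,\<^sub>n\<close> are the
  vertices \<open>Inl i\<close> with \<open>i < m\<close> and \<open>Inr j\<close> with \<open>j < n\<close>.\<close>

definition K_verts :: "nat \<Rightarrow> nat \<Rightarrow> (nat + nat) set" where
  "K_verts m n = Inl ` {..<m} \<union> Inr ` {..<n}"

definition K_edges :: "nat \<Rightarrow> nat \<Rightarrow> (nat + nat) set set" where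
  "K_edges m n = {{Inl i, Inr j} | i j. i < m \<and> j < n}"

text \<open>Edge sets of subgraphs of \<open>K\<^sub>m\<^sub>,\<^sub>n\<close> isomorphic to \<open>K\<^sub>2\<^sub>,\<^sub>3\<close>. The
  isomorphism \<open>\<phi>\<close> may place the side of size two on either side of \<open>K\<^sub>m\<^sub>,\<^sub>n\<close>.\<close>

definition K23_copies :: "nat \<Rightarrow> nat \<Rightarrow> (nat + nat) set set set" where
  "K23_copies m n =
     {X. X \<subseteq> K_edges m n \<and>
         (\<exists>\<phi> :: nat + nat \<Rightarrow> nat + nat.
            inj_on \<phi> (K_verts 2 3) \<and> X = (\<lambda>e. \<phi> ` e) ` K_edges 2 3)}"

definition K23_matroid :: "nat \<Rightarrow> nat \<Rightarrow> (nat + nat) set set set \<Rightarrow> bool" where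
  "K23_matroid m n M \<longleftrightarrow>
     matroid_on (K_edges m n) M \<and> (\<forall>X\<in>K23_copies m n. circuit (K_edges m n) M X)"

definition maximal_K23_matroid :: "nat \<Rightarrow> nat \<Rightarrow> (nat + nat) set set set \<Rightarrow> bool" where
  "maximal_K23_matroid m n M \<longleftrightarrow>
     K23_matroid m n M \<and> (\<forall>N. K23_matroid m n N \<longrightarrow> weak_le M N \<longrightarrow> N = M)"

definition f10 :: "'v set set \<Rightarrow> nat" where
  "f10 F = card (\<Union> F)"

abbreviation M_f10 :: "nat \<Rightarrow> nat \<Rightarrow> (nat + nat) set set set" where
  "M_f10 m n \<equiv> count_matroid f10 (K_edges m n)"

abbreviation val_K23 :: "nat \<Rightarrow> nat \<Rightarrow> (nat + nat) set set \<Rightarrow> int" where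
  "val_K23 m n \<equiv> val_min (K23_copies m n)"

text \<open>The minimum in \<open>val_K23\<close> ranges over a finite nonempty set.\<close>

lemma finite_K_edges: "finite (K_edges m n)"
proof -
  have "K_edges m n = (\<lambda>(i, j). {Inl i, Inr j}) ` ({..<m} \<times> {..<n})"
    by (auto simp: K_edges_def)
  then show ?thesis by simp
qed

lemma finite_K23_copies: "finite (K23_copies m n)"
  by (rule finite_subset[of _ "Pow (K_edges m n)"])
    (auto simp: K23_copies_def finite_K_edges)

lemma proper_seq_distinct:
  assumes "proper_seq X S"
  shows "distinct S"
proof -
  have "S ! i \<noteq> S ! j" if "i < j" "j < length S" for i j
    using assms that unfolding proper_seq_def by (metis UN_upper lessThan_iff less_one not_le less_nat_zero_code)
  then show ?thesis
    unfolding distinct_conv_nth by (metis nat_neq_iff)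
qed

lemma finite_proper_seqs: "finite X \<Longrightarrow> finite {S. proper_seq X S}"
  by (rule finite_subset[OF _ finite_subset_distinct[of X]])
    (auto simp: proper_seq_distinct, auto simp: proper_seq_def)

lemma finite_val_K23_values: "finite {val F S | S. proper_seq (K23_copies m n) S}"
  using finite_proper_seqs[OF finite_K23_copies] by simp

lemma proper_seq_Nil: "proper_seq X []"
  by (simp add: proper_seq_def)

end

theory Submission
  imports Defs
begin

text \<open>The independent sets \<open>I\<close> that are maximal in \<open>F\<close> satisfy
  \<open>|I| = |F - Z| + |V(Z)|\<close> for some \<open>Z \<subseteq> F\<close>, namely \<open>F - I\<close> together with the largest
  tight subset of \<open>I\<close>; the right-hand side bounds every independent subset of \<open>F\<close>. Hence
  the count matroid is a matroid. If \<open>A\<close> and \<open>B\<close> are the two sides of \<open>V(Z)\<close>, then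
  either \<open>|Z| \<le> |V(Z)|\<close>, so that \<open>F\<close> is independent, or the complete bipartite graph on
  \<open>A, B\<close> is the union of a proper sequence of \<open>|A||B| - |A| - |B|\<close> copies of \<open>K\<^sub>2\<^sub>,\<^sub>3\<close>, which
  has value at most \<open>|I|\<close>. Conversely, in every matroid in which the copies of
  \<open>K\<^sub>2\<^sub>,\<^sub>3\<close> are circuits, each member of a proper sequence lowers the rank by one, so values of
  proper sequences bound the rank of every such matroid from above.\<close>

section \<open>Count matroids of set systems\<close>

lemma count_matroid_f10_card_le:
  assumes "J \<in> count_matroid f10 E" "T \<subseteq> J"
  shows "card T \<le> card (\<Union>T)"
  using assms by (cases "T = {}") (auto simp: count_matroid_def f10_def)

text \<open>Members of \<open>J\<close> outside \<open>Z\<close> are counted one by one, those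
  inside \<open>Z\<close> through the vertices they cover. This is the upper half of a rank
  formula.\<close>

lemma count_matroid_f10_card_le_cover:
  assumes "J \<in> count_matroid f10 E" "J \<subseteq> F" "finite F" "\<And>e. e \<in> F \<Longrightarrow> finite e"
  shows "card J \<le> card (F - Z) + card (\<Union>(F \<inter> Z))"
proof -
  have "card J \<le> card (J - Z) + card (J \<inter> Z)"
    by (metis Un_Diff_Int card_Un_le)
  moreover have "card (J - Z) \<le> card (F - Z)"
    using assms by (intro card_mono) auto
  moreover have "card (J \<inter> Z) \<le> card (\<Union>(J \<inter> Z))"
    using assms(1) by (rule count_matroid_f10_card_le) auto
  moreover have "card (\<Union>(J \<inter> Z)) \<le> card (\<Union>(F \<inter> Z))"
    using assms by (intro card_mono) auto
  ultimately show ?thesis by linarith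
qed

text \<open>Uncrossing: the union \<open>T\<close> of all tight subsets of \<open>I\<close> is
  tight, and every member of \<open>F - I\<close> lies inside \<open>\<Union>T\<close>. Adding
  \<open>F - I\<close> to \<open>T\<close> therefore covers no new vertex, which yields a
  \<open>Z\<close> attaining the upper bound.\<close>

lemma count_matroid_f10_maximal_card:
  assumes finF: "finite F" and fine: "\<And>e. e \<in> F \<Longrightarrow> finite e" and FE: "F \<subseteq> E"
    and IF: "I \<subseteq> F" and I: "I \<in> count_matroid f10 E"
    and max: "\<And>x. x \<in> F - I \<Longrightarrow> insert x I \<notin> count_matroid f10 E"
  obtains Z where "Z \<subseteq> F" "card I = card (F - Z) + card (\<Union>Z)"
proof -
  have finI: "finite I" using IF finF by (rule finite_subset)
  have finU: "finite (\<Union>T)" if "T \<subseteq> F" for T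
    using that finF fine by (meson finite_Union finite_subset subsetD)
  define tight where "tight T \<longleftrightarrow> T \<subseteq> I \<and> card T = card (\<Union>T)" for T
  \<comment> \<open>Cardinality is modular, the number of covered vertices is submodular. Neither
    \<open>S \<union> T\<close> nor \<open>S \<inter> T\<close> has more members than vertices, so
    equality for \<open>S\<close> and \<open>T\<close> forces equality for the union.\<close>
  have tight_Un: "tight (S \<union> T)" if "tight S" "tight T" for S T
  proof -
    have sub: "S \<subseteq> I" "T \<subseteq> I" and eq: "card S = card (\<Union>S)" "card T = card (\<Union>T)"
      using that by (auto simp: tight_def)
    have fin: "finite S" "finite T" "finite (\<Union>S)" "finite (\<Union>T)"
      using sub IF finI finU by (auto intro: finite_subset)
    have "card (S \<inter> T) \<le> card (\<Union>(S \<inter> T))"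
      using I sub by (intro count_matroid_f10_card_le) auto
    also have "\<dots> \<le> card (\<Union>S \<inter> \<Union>T)"
      using fin by (intro card_mono) auto
    finally have "card (S \<inter> T) \<le> card (\<Union>S \<inter> \<Union>T)" .
    moreover have "card S + card T = card (S \<union> T) + card (S \<inter> T)"
      using fin by (intro card_Un_Int)
    moreover have "card (\<Union>S) + card (\<Union>T) = card (\<Union>(S \<union> T)) + card (\<Union>S \<inter> \<Union>T)"
      using card_Un_Int[OF fin(3,4)] by (simp add: Union_Un_distrib)
    moreover have "card (S \<union> T) \<le> card (\<Union>(S \<union> T))"
      using I sub by (intro count_matroid_f10_card_le) auto
    ultimately show ?thesis using sub eq by (simp add: tight_def)
  qed
  have tight_Union: "tight (\<Union>\<T>)" if "finite \<T>" "\<And>T. T \<in> \<T> \<Longrightarrow> tight T" for \<T>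
    using that by (induction rule: finite_induct) (simp_all add: tight_def[of "{}"] tight_Un)
  define T where "T = \<Union>{T. tight T}"
  have "finite {T. tight T}"
    by (rule finite_subset[of _ "Pow I"]) (auto simp: tight_def finI)
  then have T: "tight T" unfolding T_def by (rule tight_Union) simp
  have span: "x \<subseteq> \<Union>T" if x: "x \<in> F - I" for x
  proof -
    have "insert x I \<subseteq> E" using x IF FE by auto
    then obtain J where J: "J \<subseteq> insert x I" "card (\<Union>J) < card J"
      using max[OF x] unfolding count_matroid_def f10_def mem_Collect_eq by (meson not_le)
    have "x \<in> J"
    proof (rule ccontr)
      assume "x \<notin> J"
      then have "J \<subseteq> I" using J by auto
      then show False using count_matroid_f10_card_le[OF I, of J] J(2) by simp
    qed
    \<comment> \<open>The chain |J| - 1 = |T'| \<le> |V(T')| \<le> |V(J)| \<le> |J| - 1 collapses to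
      equalities. So \<open>T'\<close> is tight and already covers every vertex of
      \<open>x\<close>.\<close>
    define T' where "T' = J - {x}"
    have T'I: "T' \<subseteq> I" using J by (auto simp: T'_def)
    have JF: "J \<subseteq> F" using J x IF by auto
    have "card J = Suc (card T')"
      unfolding T'_def using \<open>x \<in> J\<close> JF finF by (meson card.remove finite_subset)
    moreover have "card T' \<le> card (\<Union>T')"
      using I T'I by (rule count_matroid_f10_card_le)
    moreover have "card (\<Union>T') \<le> card (\<Union>J)"
      using finU[OF JF] by (intro card_mono) (auto simp: T'_def)
    ultimately have "card T' = card (\<Union>T')" "card (\<Union>T') = card (\<Union>J)"
      using J by linarith+
    then have "\<Union>T' = \<Union>J"
      using finU[OF JF] by (intro card_subset_eq) (auto simp: T'_def)
    moreover have "T' \<subseteq> T"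
      using \<open>card T' = card (\<Union>T')\<close> T'I by (auto simp: T_def tight_def)
    ultimately show ?thesis using \<open>x \<in> J\<close> by blast
  qed
  have TI: "T \<subseteq> I" and Tcard: "card T = card (\<Union>T)" using T by (auto simp: tight_def)
  \<comment> \<open>By \<open>span\<close>, |V(Z)| = |V(T)| = |T|, while the rest of
    \<open>F\<close> is exactly \<open>I - T\<close>.\<close>
  define Z where "Z = T \<union> (F - I)"
  have "\<Union>Z = \<Union>T" using span by (auto simp: Z_def)
  moreover have "F - Z = I - T" using IF TI by (auto simp: Z_def)
  moreover have "card I = card (I - T) + card T"
    using TI finI by (metis card_Diff_subset card_mono finite_subset le_add_diff_inverse2)
  ultimately have "card I = card (F - Z) + card (\<Union>Z)"
    using Tcard by simp
  moreover have "Z \<subseteq> F" using TI IF by (auto simp: Z_def)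
  ultimately show thesis using that by blast
qed

text \<open>If exchange failed, \<open>A\<close> would be maximal in \<open>A \<union> B\<close>.
  Then |A| would equal a bound valid for every independent subset of \<open>A \<union> B\<close>,
  against |A| < |B|.\<close>

lemma matroid_on_count_matroid_f10:
  assumes finE: "finite E" and fine: "\<And>e. e \<in> E \<Longrightarrow> finite e"
  shows "matroid_on E (count_matroid f10 E)"
proof -
  let ?M = "count_matroid f10 E"
  have "\<exists>x\<in>B - A. insert x A \<in> ?M" if A: "A \<in> ?M" and B: "B \<in> ?M" and less: "card A < card B" for A B
  proof (rule ccontr)
    assume "\<not> ?thesis"
    then have max: "\<And>x. x \<in> (A \<union> B) - A \<Longrightarrow> insert x A \<notin> ?M" by auto
    have sub: "A \<union> B \<subseteq> E" using A B by (auto simp: count_matroid_def)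
    then have fin: "finite (A \<union> B)" using finE by (rule finite_subset)
    obtain Z where Z: "Z \<subseteq> A \<union> B" "card A = card (A \<union> B - Z) + card (\<Union>Z)"
      using count_matroid_f10_maximal_card[OF fin _ sub _ A max] fine sub by blast
    have "card B \<le> card (A \<union> B - Z) + card (\<Union>((A \<union> B) \<inter> Z))"
      using B fin fine sub by (intro count_matroid_f10_card_le_cover) auto
    then show False using Z less by (simp add: Int_absorb1)
  qed
  moreover have "\<forall>A\<in>?M. \<forall>B. B \<subseteq> A \<longrightarrow> B \<in> ?M"
    unfolding count_matroid_def by blast
  ultimately show ?thesis
    using finE unfolding matroid_on_def by (auto simp: count_matroid_def)
qed

section \<open>Values of proper sequences bound the rank\<close>

lemma matroid_on_extend_maximal:
  assumes M: "matroid_on E M" and A: "A \<in> M" "A \<subseteq> F" and finF: "finite F"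
  obtains B where "A \<subseteq> B" "B \<subseteq> F" "B \<in> M" "\<And>x. x \<in> F - B \<Longrightarrow> insert x B \<notin> M"
proof -
  let ?P = "\<lambda>B. A \<subseteq> B \<and> B \<subseteq> F \<and> B \<in> M"
  have "finite {B. ?P B}" by (rule finite_subset[of _ "Pow F"]) (auto simp: finF)
  then have "\<exists>B\<in>{B. ?P B}. \<forall>C\<in>{B. ?P B}. B \<subseteq> C \<longrightarrow> B = C"
    by (rule finite_has_maximal) (use A in auto)
  then obtain B where B: "?P B" and max: "\<And>C. ?P C \<Longrightarrow> B \<subseteq> C \<Longrightarrow> B = C"
    unfolding bex_simps ball_simps mem_Collect_eq by auto
  show thesis
  proof (rule that[of B])
    show "insert x B \<notin> M" if "x \<in> F - B" for x
      using max[of "insert x B"] B that by blast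
  qed (use B in auto)
qed

text \<open>Makes induction from the right available. The guard \<open>S \<noteq> []\<close>
  reflects that the first member of a proper sequence carries no condition.\<close>

lemma proper_seq_snoc:
  "proper_seq \<X> (S @ [X]) \<longleftrightarrow>
     proper_seq \<X> S \<and> X \<in> \<X> \<and> (S \<noteq> [] \<longrightarrow> \<not> X \<subseteq> \<Union>(set S))"
proof -
  have U: "(\<Union>j<i. (S @ [X]) ! j) = (\<Union>j<i. S ! j)" if "i \<le> length S" for i
    using that by (auto simp: nth_append)
  have V: "(\<Union>j<length S. S ! j) = \<Union>(set S)"
    by (auto simp: set_conv_nth)
  have "(\<forall>i. 1 \<le> i \<longrightarrow> i < length (S @ [X]) \<longrightarrow>
            \<not> (S @ [X]) ! i \<subseteq> (\<Union>j<i. (S @ [X]) ! j)) \<longleftrightarrow>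
        (\<forall>i. 1 \<le> i \<longrightarrow> i < length S \<longrightarrow> \<not> S ! i \<subseteq> (\<Union>j<i. S ! j)) \<and>
        (S \<noteq> [] \<longrightarrow> \<not> X \<subseteq> \<Union>(set S))" (is "?L \<longleftrightarrow> ?R \<and> ?Q")
  proof (intro iffI conjI)
    assume L: ?L
    show ?R
    proof (intro allI impI)
      fix i assume "1 \<le> i" "i < length S"
      then show "\<not> S ! i \<subseteq> (\<Union>j<i. S ! j)"
        using L[rule_format, of i] U[of i] by (simp add: nth_append)
    qed
    show ?Q
      using L[rule_format, of "length S"] U[of "length S"] V by (cases S) simp_all
  next
    assume R: "?R \<and> ?Q"
    show ?L
    proof (intro allI impI)
      fix i assume i: "1 \<le> i" "i < length (S @ [X])"
      show "\<not> (S @ [X]) ! i \<subseteq> (\<Union>j<i. (S @ [X]) ! j)"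
      proof (cases "i = length S")
        case True
        then show ?thesis using R i U[of i] V by auto
      next
        case False
        then have "i < length S" using i by simp
        then show ?thesis using R i U[of i] by (simp add: nth_append)
      qed
    qed
  qed
  then show ?thesis unfolding proper_seq_def by auto
qed

text \<open>Deleting one element of a circuit does not lower the rank. Take \<open>B\<close> maximal
  in \<open>W - {e}\<close> above \<open>X - {e}\<close>; if \<open>J\<close> were larger, exchange
  could only add \<open>e\<close>, and the result would be an independent set containing the
  circuit.\<close>

lemma matroid_on_circuit_avoid:
  assumes M: "matroid_on E M" and X: "circuit E M X" "X \<subseteq> W" "e \<in> X" and finW: "finite W"
    and J: "J \<in> M" "J \<subseteq> W"
  obtains J' where "J' \<in> M" "J' \<subseteq> W - {e}" "card J \<le> card J'"
proof -
  have "X - {e} \<in> M" using X unfolding circuit_def by blast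
  then obtain B where B: "X - {e} \<subseteq> B" "B \<subseteq> W - {e}" "B \<in> M"
    and max: "\<And>x. x \<in> W - {e} - B \<Longrightarrow> insert x B \<notin> M"
    using matroid_on_extend_maximal[OF M, of "X - {e}" "W - {e}"] X(2) finW by blast
  have "card J \<le> card B"
  proof (rule ccontr)
    assume "\<not> ?thesis"
    then obtain x where x: "x \<in> J - B" "insert x B \<in> M"
      using M B(3) J(1) unfolding matroid_on_def by (meson not_le)
    then have "x = e" using max J(2) by blast
    then have "X \<subseteq> insert x B" using B(1) by blast
    then have "X \<in> M" using x(2) M unfolding matroid_on_def by blast
    then show False using X(1) by (simp add: circuit_def)
  qed
  then show thesis using B that by blast
qed

text \<open>The last member \<open>X\<close> has an element \<open>e\<close> outside the union
  \<open>W\<close> of the earlier ones. Trading \<open>J\<close> for a set that avoids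
  \<open>e\<close> and is at least as large shows that \<open>X\<close> contributes at most |X - W|
  - 1 beyond \<open>W\<close>.\<close>

lemma card_indep_proper_seq_Union:
  assumes M: "matroid_on E M" and circ: "\<And>X. X \<in> \<X> \<Longrightarrow> circuit E M X"
    and "proper_seq \<X> S" "J \<in> M" "J \<subseteq> \<Union>(set S)"
  shows "card J + length S \<le> card (\<Union>(set S))"
  using assms(3-)
proof (induction S arbitrary: J rule: rev_induct)
  case Nil
  then show ?case by simp
next
  case (snoc X S)
  let ?W = "\<Union>(set S)"
  have S: "proper_seq \<X> S" and X: "X \<in> \<X>" and new: "S \<noteq> [] \<longrightarrow> \<not> X \<subseteq> ?W"
    using snoc.prems(1) by (auto simp: proper_seq_snoc)
  have "finite E" using M by (simp add: matroid_on_def)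
  moreover have "?W \<union> X \<subseteq> E"
    using S X circ unfolding proper_seq_def circuit_def by blast
  ultimately have finW: "finite (?W \<union> X)" by (metis finite_subset)
  \<comment> \<open>For the first member properness provides no new element; there \<open>e\<close>
    exists because the empty set is independent and so no circuit.\<close>
  have "X \<noteq> {}" using circ[OF X] M unfolding circuit_def matroid_on_def by blast
  then obtain e where e: "e \<in> X" "e \<notin> ?W" using new by (cases S) auto
  have "J \<subseteq> ?W \<union> X" using snoc.prems(3) by auto
  then obtain J' where J': "J' \<in> M" "J' \<subseteq> ?W \<union> X - {e}" "card J \<le> card J'"
    using matroid_on_circuit_avoid[OF M circ[OF X] _ e(1) finW snoc.prems(2)] by blast
  have "J' \<inter> ?W \<in> M" using J'(1) M unfolding matroid_on_def by (meson inf_le1)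
  then have "card (J' \<inter> ?W) + length S \<le> card ?W" using snoc.IH[OF S] by blast
  moreover have "card J' \<le> card (J' \<inter> ?W) + card (X - ?W - {e})"
  proof -
    have "card J' \<le> card ((J' \<inter> ?W) \<union> (X - ?W - {e}))"
      using finW J'(2) by (intro card_mono) (auto intro: finite_subset)
    also have "\<dots> \<le> card (J' \<inter> ?W) + card (X - ?W - {e})" by (rule card_Un_le)
    finally show ?thesis .
  qed
  moreover have "Suc (card (X - ?W - {e})) = card (X - ?W)"
    using e finW by (intro card.remove[symmetric]) auto
  moreover have "card (?W \<union> X) = card ?W + card (X - ?W)"
    using finW card_Un_disjoint[of ?W "X - ?W"] by (simp add: Un_Diff_cancel)
  ultimately have "card J + Suc (length S) \<le> card (?W \<union> X)" using J'(3) by linarith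
  then show ?case by (simp add: Un_commute)
qed

text \<open>The part of \<open>J\<close> in the union obeys the previous bound, and each further
  element of \<open>F\<close> adds at most one. As \<open>M\<close> is arbitrary, this applies to
  the count matroid and to every competitor in the weak order.\<close>

lemma card_indep_le_val:
  assumes M: "matroid_on E M" and circ: "\<And>X. X \<in> \<X> \<Longrightarrow> circuit E M X"
    and S: "proper_seq \<X> S" and J: "J \<in> M" "J \<subseteq> F" and "F \<subseteq> E"
  shows "int (card J) \<le> val F S"
proof -
  let ?W = "\<Union>(set S)"
  have "finite E" using M by (simp add: matroid_on_def)
  moreover have "F \<union> ?W \<subseteq> E"
    using S circ \<open>F \<subseteq> E\<close> unfolding proper_seq_def circuit_def by blast
  ultimately have fin: "finite (F \<union> ?W)" by (metis finite_subset)
  have "J \<inter> ?W \<in> M" using J(1) M unfolding matroid_on_def by (meson inf_le1)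
  then have "card (J \<inter> ?W) + length S \<le> card ?W"
    using card_indep_proper_seq_Union[OF M circ S] by blast
  moreover have "card J \<le> card (J \<inter> ?W) + card (F - ?W)"
  proof -
    have "card J \<le> card ((J \<inter> ?W) \<union> (F - ?W))"
      using fin J(2) by (intro card_mono) (auto intro: finite_subset)
    also have "\<dots> \<le> card (J \<inter> ?W) + card (F - ?W)" by (rule card_Un_le)
    finally show ?thesis .
  qed
  moreover have "card (F \<union> ?W) = card ?W + card (F - ?W)"
    using fin card_Un_disjoint[of ?W "F - ?W"] by (simp add: Un_Diff_cancel Un_commute)
  ultimately show ?thesis by (simp add: val_def)
qed

section \<open>Covering complete bipartite graphs by proper sequences\<close>

text \<open>An abstract edge map \<open>e\<close> makes the two sides of the bipartite graph interchangeable.\<close>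

definition grid :: "('a \<Rightarrow> 'b \<Rightarrow> 'e) \<Rightarrow> 'a set \<Rightarrow> 'b set \<Rightarrow> 'e set" where
  "grid e A B = (\<lambda>(a, b). e a b) ` (A \<times> B)"

definition seq_covers :: "'e set set \<Rightarrow> 'e set \<Rightarrow> nat \<Rightarrow> bool" where
  "seq_covers \<X> W k \<longleftrightarrow> (\<exists>S. proper_seq \<X> S \<and> \<Union>(set S) = W \<and> length S = k)"

lemma grid_swap: "grid (\<lambda>b a. e a b) B A = grid e A B"
  unfolding grid_def by force

lemma mem_grid_iff:
  assumes "\<And>a b a' b'. e a b = e a' b' \<Longrightarrow> a = a' \<and> b = b'"
  shows "e a b \<in> grid e A B \<longleftrightarrow> a \<in> A \<and> b \<in> B"
  using assms unfolding grid_def by auto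

lemma seq_covers_step:
  assumes "seq_covers \<X> W k" "X \<in> \<X>" "\<not> X \<subseteq> W"
  shows "seq_covers \<X> (W \<union> X) (Suc k)"
proof -
  obtain S where "proper_seq \<X> S" "\<Union>(set S) = W" "length S = k"
    using assms(1) by (auto simp: seq_covers_def)
  then show ?thesis
    using assms(2,3) unfolding seq_covers_def
    by (intro exI[of _ "S @ [X]"]) (auto simp: proper_seq_snoc)
qed

lemma seq_covers_singleton: "X \<in> \<X> \<Longrightarrow> seq_covers \<X> X 1"
  unfolding seq_covers_def by (intro exI[of _ "[X]"]) (simp add: proper_seq_def)

text \<open>The first copy adds two edges at the new vertex \<open>v\<close>, every further copy adds one.\<close>

lemma seq_covers_add_vertex:
  assumes inj: "\<And>a b a' b'. e a b = e a' b' \<Longrightarrow> a = a' \<and> b = b'"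
    and X32: "\<And>A' B'. A' \<subseteq> insert v A \<Longrightarrow> B' \<subseteq> B \<Longrightarrow> card A' = 3 \<Longrightarrow> card B' = 2 \<Longrightarrow> grid e A' B' \<in> \<X>"
    and cov: "seq_covers \<X> (grid e A B) k"
    and A: "2 \<le> card A" and v: "v \<notin> A" and B: "finite B" "2 \<le> card B"
  shows "seq_covers \<X> (grid e (insert v A) B) (k + card B - 1)"
proof -
  obtain A2 where A2: "A2 \<subseteq> A" "card A2 = 2" "finite A2"
    using A by (meson obtain_subset_with_card_n)
  have A3: "insert v A2 \<subseteq> insert v A" "card (insert v A2) = 3"
    using A2 v by (auto simp: card_insert_if)
  obtain b where b: "b \<in> B" using B by fastforce
  \<comment> \<open>All copies at \<open>v\<close> share the edge \<open>e v b\<close>, and their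
    edges away from \<open>v\<close> lie in the old grid. The induction starts at a singleton
    because the first copy brings both \<open>e v b\<close> and \<open>e v c\<close>:
    \<open>card C\<close> copies cover \<open>card C + 1\<close> edges at \<open>v\<close>.\<close>
  have main: "seq_covers \<X> (grid e A B \<union> grid e {v} (insert b C)) (k + card C)"
    if "finite C" "C \<noteq> {}" "C \<subseteq> B - {b}" for C
    using that
  proof (induction rule: finite_ne_induct)
    case (singleton c)
    let ?X = "grid e (insert v A2) {b, c}"
    have "?X \<in> \<X>" using A3 singleton b by (intro X32) (auto simp: card_insert_if)
    moreover have "e v b \<in> ?X" "e v b \<notin> grid e A B"
      using v by (simp_all add: mem_grid_iff[of e, OF inj])
    moreover have "grid e A B \<union> ?X = grid e A B \<union> grid e {v} {b, c}"
      using A2 b singleton unfolding grid_def by auto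
    ultimately show ?case using seq_covers_step[OF cov, of ?X] by auto
  next
    case (insert c C)
    let ?X = "grid e (insert v A2) {b, c}" and ?W = "grid e A B \<union> grid e {v} (insert b C)"
    have "?X \<in> \<X>" using A3 insert.prems b by (intro X32) (auto simp: card_insert_if)
    moreover have "e v c \<in> ?X" "e v c \<notin> ?W"
      using v insert.hyps insert.prems by (auto simp: mem_grid_iff[of e, OF inj])
    moreover have "?W \<union> ?X = grid e A B \<union> grid e {v} (insert b (insert c C))"
      using A2 b insert.prems unfolding grid_def by auto
    moreover have "seq_covers \<X> ?W (k + card C)" using insert by auto
    ultimately show ?case
      using seq_covers_step[of \<X> ?W "k + card C" ?X] insert.hyps by auto
  qed
  have "card (B - {b}) = card B - 1" using b B by simp
  moreover from this have "B - {b} \<noteq> {}" using B by force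
  ultimately have "seq_covers \<X> (grid e A B \<union> grid e {v} (insert b (B - {b}))) (k + (card B - 1))"
    using main[of "B - {b}"] B by simp
  moreover have "grid e A B \<union> grid e {v} (insert b (B - {b})) = grid e (insert v A) B"
    using b unfolding grid_def by auto
  ultimately show ?thesis using B by simp
qed

lemma seq_covers_add_vertices:
  assumes inj: "\<And>a b a' b'. e a b = e a' b' \<Longrightarrow> a = a' \<and> b = b'"
    and X32: "\<And>A' B'. A' \<subseteq> A \<union> D \<Longrightarrow> B' \<subseteq> B \<Longrightarrow> card A' = 3 \<Longrightarrow> card B' = 2 \<Longrightarrow> grid e A' B' \<in> \<X>"
    and cov: "seq_covers \<X> (grid e A B) k"
    and A: "2 \<le> card A" and B: "finite B" "2 \<le> card B"
    and D: "finite D" "D \<inter> A = {}"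
  shows "seq_covers \<X> (grid e (A \<union> D) B) (k + card D * (card B - 1))"
  using D X32
proof (induction D rule: finite_induct)
  case empty
  then show ?case using cov by simp
next
  case (insert v D)
  have finA: "finite A" using A by (intro card_ge_0_finite) simp
  have "seq_covers \<X> (grid e (A \<union> D) B) (k + card D * (card B - 1))"
    using insert.prems(1) by (intro insert.IH insert.prems(2)) auto
  moreover have "2 \<le> card (A \<union> D)"
    using A finA insert.hyps by (meson card_mono finite_UnI le_trans Un_upper1)
  ultimately have "seq_covers \<X> (grid e (insert v (A \<union> D)) B) (k + card D * (card B - 1) + card B - 1)"
    using insert.hyps insert.prems(1)
    by (intro seq_covers_add_vertex[OF inj] insert.prems(2) B) auto
  moreover have "k + card D * (card B - 1) + card B - 1 = k + card (insert v D) * (card B - 1)"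
    using insert.hyps B by simp
  ultimately show ?case by simp
qed

text \<open>Start from one copy on \<open>A2\<close> and \<open>B3\<close>, enlarge
  \<open>B3\<close> to \<open>B\<close>, then \<open>A2\<close> to \<open>A\<close>. The number of
  copies is 1 + (|B| - 3) + (|A| - 2)(|B| - 1) = |A||B| - |A| - |B|; the additive form of the
  conclusion avoids truncated subtraction.\<close>

lemma seq_covers_grid:
  assumes inj: "\<And>a b a' b'. e a b = e a' b' \<Longrightarrow> a = a' \<and> b = b'"
    and X32: "\<And>A' B'. A' \<subseteq> A \<Longrightarrow> B' \<subseteq> B \<Longrightarrow> card A' = 3 \<Longrightarrow> card B' = 2 \<Longrightarrow> grid e A' B' \<in> \<X>"
    and X23: "\<And>A' B'. A' \<subseteq> A \<Longrightarrow> B' \<subseteq> B \<Longrightarrow> card A' = 2 \<Longrightarrow> card B' = 3 \<Longrightarrow> grid e A' B' \<in> \<X>"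
    and fin: "finite A" "finite B" and A: "2 \<le> card A" and B: "3 \<le> card B"
  obtains k where "seq_covers \<X> (grid e A B) k" "k + card A + card B = card A * card B"
proof -
  obtain A2 where A2: "A2 \<subseteq> A" "card A2 = 2" "finite A2"
    using A by (meson obtain_subset_with_card_n)
  obtain B3 where B3: "B3 \<subseteq> B" "card B3 = 3" "finite B3"
    using B by (meson obtain_subset_with_card_n)
  let ?r = "\<lambda>b a. e a b"
  have "seq_covers \<X> (grid ?r B3 A2) 1"
    unfolding grid_swap[of e] using A2 B3 by (intro seq_covers_singleton X23)
  \<comment> \<open>With the transposed edge map the new vertices belong to \<open>B\<close>. The
    opposite side \<open>A2\<close> has two vertices, so each new vertex costs one copy.\<close>
  then have "seq_covers \<X> (grid ?r (B3 \<union> (B - B3)) A2) (1 + card (B - B3) * (card A2 - 1))"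
  proof (rule seq_covers_add_vertices[rotated 2])
    show "grid ?r A' B' \<in> \<X>" if "A' \<subseteq> B3 \<union> (B - B3)" "B' \<subseteq> A2" "card A' = 3" "card B' = 2" for A' B'
      unfolding grid_swap[of e] using that A2 B3 by (intro X23) auto
  qed (use inj A2 B3 fin in auto)
  moreover have "B3 \<union> (B - B3) = B" "card (B - B3) = card B - 3" "card (A - A2) = card A - 2"
    "A2 \<union> (A - A2) = A"
    using A2 B3 by (auto simp: card_Diff_subset)
  ultimately have "seq_covers \<X> (grid e A2 B) (1 + (card B - 3))"
    using A2 by (simp add: grid_swap[of e])
  then have "seq_covers \<X> (grid e (A2 \<union> (A - A2)) B) (1 + (card B - 3) + card (A - A2) * (card B - 1))"
    by (rule seq_covers_add_vertices[rotated 2])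
      (use inj A2 B fin \<open>A2 \<union> (A - A2) = A\<close> in \<open>auto intro: X32\<close>)
  then have "seq_covers \<X> (grid e A B) (1 + (card B - 3) + (card A - 2) * (card B - 1))"
    using \<open>A2 \<union> (A - A2) = A\<close> \<open>card (A - A2) = card A - 2\<close> by simp
  moreover have "1 + (card B - 3) + (card A - 2) * (card B - 1) + card A + card B = card A * card B"
  proof -
    obtain p q where "card A = p + 2" "card B = q + 3"
      using A B by (metis add.commute le_Suc_ex)
    then show ?thesis by (simp add: algebra_simps)
  qed
  ultimately show thesis using that by blast
qed

section \<open>The complete bipartite graph\<close>

abbreviation bedge :: "nat \<Rightarrow> nat \<Rightarrow> (nat + nat) set" where
  "bedge i j \<equiv> {Inl i, Inr j}"

lemma bedge_inj: "bedge i j = bedge i' j' \<Longrightarrow> i = i' \<and> j = j'"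
  by (auto simp: doubleton_eq_iff)

lemma K_edges_eq_grid: "K_edges m n = grid bedge {..<m} {..<n}"
  by (auto simp: K_edges_def grid_def)

lemma card_grid_bedge: "card (grid bedge A B) = card A * card B"
  unfolding grid_def by (subst card_image) (auto simp: inj_on_def doubleton_eq_iff card_cartesian_product)

lemma finite_K_edge: "x \<in> K_edges m n \<Longrightarrow> finite x"
  by (auto simp: K_edges_def)

text \<open>Encloses an arbitrary edge set in a complete bipartite graph whose sides are the left
  and right ends of its edges, so that the vertex count is kept.\<close>

lemma bipartite_sides:
  assumes "Z \<subseteq> K_edges m n"
  obtains A B where "A \<subseteq> {..<m}" "B \<subseteq> {..<n}" "Z \<subseteq> grid bedge A B" "card (\<Union>Z) = card A + card B"
proof -
  define A where "A = {i. Inl i \<in> \<Union>Z}"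
  define B where "B = {j. Inr j \<in> \<Union>Z}"
  have A: "A \<subseteq> {..<m}" and B: "B \<subseteq> {..<n}"
    using assms by (force simp: A_def B_def K_edges_def)+
  have U: "\<Union>Z = A <+> B"
  proof (rule set_eqI)
    fix x show "x \<in> \<Union>Z \<longleftrightarrow> x \<in> A <+> B"
      by (cases x) (auto simp: A_def B_def)
  qed
  have "Z \<subseteq> grid bedge A B"
  proof
    fix z assume z: "z \<in> Z"
    then obtain i j where "z = bedge i j" using assms by (force simp: K_edges_def)
    moreover from this have "i \<in> A" "j \<in> B" using z by (auto simp: A_def B_def)
    ultimately show "z \<in> grid bedge A B" by (auto simp: grid_def)
  qed
  moreover have "card (\<Union>Z) = card A + card B"
    unfolding U using A B by (intro card_Plus) (auto intro: finite_subset)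
  ultimately show thesis using that A B by blast
qed

text \<open>Over the integers the inequality reads (a - 1)(b - 1) \<le> 1. The hypothesis says that
  the complete bipartite graph with sides of sizes \<open>a\<close> and \<open>b\<close> contains no
  K_{2,3}.\<close>

lemma mult_le_add_of_small:
  fixes a b :: nat
  assumes "a \<le> 1 \<or> b \<le> 1 \<or> (a \<le> 2 \<and> b \<le> 2)"
  shows "a * b \<le> a + b"
proof -
  consider "a = 0" | "a = 1" | "b = 0" | "b = 1" | "a = 2" "b = 2" | "a = 2" "b \<le> 1" | "b = 2" "a \<le> 1"
    using assms by linarith
  then show ?thesis by cases auto
qed

section \<open>Copies of K_{2,3} as circuits of the count matroid\<close>

text \<open>If \<open>I\<close> covers all five vertices, it has at most five edges because one of
  the six is missing. Otherwise its sides are too small for the complete bipartite graph on them to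
  have more edges than vertices.\<close>

lemma card_le_card_Union_of_proper_K23:
  assumes "I \<subset> K_edges 2 3"
  shows "card I \<le> card (\<Union>I)"
proof -
  obtain A B where AB: "A \<subseteq> {..<2}" "B \<subseteq> {..<3}" "I \<subseteq> grid bedge A B"
    "card (\<Union>I) = card A + card B"
    by (rule bipartite_sides[OF psubset_imp_subset[OF assms]])
  have fin: "finite (grid bedge A B)"
    using AB(1,2) unfolding grid_def by (auto intro: finite_subset)
  have le: "card A \<le> 2" "card B \<le> 3"
    using AB(1,2) card_mono[of "{..<2::nat}" A] card_mono[of "{..<3::nat}" B] by auto
  have I: "card I \<le> card A * card B"
    using AB(3) fin by (metis card_grid_bedge card_mono)
  have "card I < 6"
    using psubset_card_mono[OF finite_K_edges assms] by (simp add: K_edges_eq_grid card_grid_bedge)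
  show ?thesis
  proof (cases "card A = 2 \<and> card B = 3")
    case True
    then show ?thesis using AB(4) \<open>card I < 6\<close> by simp
  next
    case False
    then have "card A * card B \<le> card A + card B"
      using le by (intro mult_le_add_of_small) linarith
    then show ?thesis using I AB(4) by simp
  qed
qed

text \<open>A copy has six edges on five vertices. The embedding is injective on vertices, so it
  preserves both counts, and a subset of a proper subset of the copy pulls back to a proper subset
  of the standard K_{2,3}.\<close>

lemma K23_copy_circuit:
  assumes "X \<in> K23_copies m n"
  shows "circuit (K_edges m n) (M_f10 m n) X"
proof -
  obtain \<phi> where X: "X \<subseteq> K_edges m n" and inj: "inj_on \<phi> (K_verts 2 3)"
    and X_eq: "X = (\<lambda>e. \<phi> ` e) ` K_edges 2 3"
    using assms by (auto simp: K23_copies_def)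
  have verts: "\<Union>(K_edges 2 3) = K_verts 2 3"
  proof
    have "Inl i \<in> \<Union>(K_edges 2 3)" if "i < 2" for i
      using that by (intro UnionI[of "bedge i 0"]) (simp_all add: K_edges_eq_grid mem_grid_iff[of bedge, OF bedge_inj])
    moreover have "Inr j \<in> \<Union>(K_edges 2 3)" if "j < 3" for j
      using that by (intro UnionI[of "bedge 0 j"]) (simp_all add: K_edges_eq_grid mem_grid_iff[of bedge, OF bedge_inj])
    ultimately show "K_verts 2 3 \<subseteq> \<Union>(K_edges 2 3)"
      unfolding K_verts_def by blast
  qed (auto simp: K_edges_def K_verts_def)
  have "inj_on (\<lambda>e. \<phi> ` e) (K_edges 2 3)"
    using inj verts by (intro inj_onI) (metis Sup_upper inj_on_image_eq_iff)
  then have card_copy: "card ((\<lambda>e. \<phi> ` e) ` I) = card I" if "I \<subseteq> K_edges 2 3" for I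
    using that by (meson card_image inj_on_subset)
  have card_verts: "card (\<Union>((\<lambda>e. \<phi> ` e) ` I)) = card (\<Union>I)" if "I \<subseteq> K_edges 2 3" for I
  proof -
    have "\<Union>I \<subseteq> K_verts 2 3" using that verts by blast
    then show ?thesis using inj by (metis card_image image_Union inj_on_subset)
  qed
  have "card (K_verts 2 3) = 5"
    unfolding K_verts_def by (subst card_Un_disjoint) (auto simp: card_image)
  then have "card (\<Union>X) = 5" using card_verts[of "K_edges 2 3"] verts X_eq by simp
  moreover have "card X = 6"
    using card_copy[of "K_edges 2 3"] X_eq by (simp add: K_edges_eq_grid card_grid_bedge)
  ultimately have "X \<notin> M_f10 m n"
    using count_matroid_f10_card_le[of X "K_edges m n" X] by auto
  moreover have "D \<in> M_f10 m n" if D: "D \<subset> X" for D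
    unfolding count_matroid_def f10_def
  proof (intro CollectI conjI allI impI)
    show "D \<subseteq> K_edges m n" using D X by blast
    fix I assume "I \<subseteq> D"
    then obtain I0 where I0: "I0 \<subseteq> K_edges 2 3" "I = (\<lambda>e. \<phi> ` e) ` I0"
      using D X_eq by (meson psubset_imp_subset subset_image_iff subset_trans)
    then have "I0 \<subset> K_edges 2 3" using \<open>I \<subseteq> D\<close> D X_eq by blast
    then show "card I \<le> card (\<Union>I)"
      using card_le_card_Union_of_proper_K23 card_copy card_verts I0 by simp
  qed
  ultimately show ?thesis using X by (simp add: circuit_def)
qed

section \<open>Copies and covering sequences inside K_{m,n}\<close>

lemma grid_mem_K23_copies:
  assumes sub: "A \<subseteq> {..<m}" "B \<subseteq> {..<n}"
    and card: "card A = 2 \<and> card B = 3 \<or> card A = 3 \<and> card B = 2"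
  shows "grid bedge A B \<in> K23_copies m n"
proof -
  have E: "grid bedge A B \<subseteq> K_edges m n"
    using sub by (auto simp: K_edges_def grid_def)
  have K: "grid bedge (f ` {..<2}) (g ` {..<3}) = (\<lambda>e. map_sum f g ` e) ` K_edges 2 3" for f g
    by (simp add: grid_def K_edges_eq_grid image_paired_Times[symmetric] image_image case_prod_unfold)
  \<comment> \<open>When the side of size two lies on the right, the embedding must exchange the two
    summands, which \<open>map_sum\<close> cannot do.\<close>
  have K': "grid bedge (g ` {..<3}) (f ` {..<2}) = (\<lambda>e. case_sum (Inr \<circ> f) (Inl \<circ> g) ` e) ` K_edges 2 3"
    for f g :: "nat \<Rightarrow> nat"
    unfolding grid_swap[of bedge, symmetric]
    by (simp add: grid_def K_edges_eq_grid image_paired_Times[symmetric] image_image case_prod_unfold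
        insert_commute)
  have fin: "finite A" "finite B" using sub by (auto intro: finite_subset)
  from card show ?thesis
  proof
    assume c: "card A = 2 \<and> card B = 3"
    obtain f :: "nat \<Rightarrow> nat" where f: "bij_betw f {..<2} A"
      using ex_bij_betw_nat_finite[OF fin(1)] c by (auto simp: lessThan_atLeast0)
    obtain g :: "nat \<Rightarrow> nat" where g: "bij_betw g {..<3} B"
      using ex_bij_betw_nat_finite[OF fin(2)] c by (auto simp: lessThan_atLeast0)
    have "inj_on (map_sum f g) (K_verts 2 3)"
      using f g unfolding K_verts_def bij_betw_def inj_on_def by auto
    moreover have "grid bedge A B = (\<lambda>e. map_sum f g ` e) ` K_edges 2 3"
      using f g K[of f g] by (simp add: bij_betw_def)
    ultimately show ?thesis using E unfolding K23_copies_def by blast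
  next
    assume c: "card A = 3 \<and> card B = 2"
    obtain f :: "nat \<Rightarrow> nat" where f: "bij_betw f {..<2} B"
      using ex_bij_betw_nat_finite[OF fin(2)] c by (auto simp: lessThan_atLeast0)
    obtain g :: "nat \<Rightarrow> nat" where g: "bij_betw g {..<3} A"
      using ex_bij_betw_nat_finite[OF fin(1)] c by (auto simp: lessThan_atLeast0)
    have "inj_on (case_sum (Inr \<circ> f) (Inl \<circ> g)) (K_verts 2 3)"
      using f g unfolding K_verts_def bij_betw_def inj_on_def by auto
    moreover have "grid bedge A B = (\<lambda>e. case_sum (Inr \<circ> f) (Inl \<circ> g) ` e) ` K_edges 2 3"
      using f g K'[of g f] by (simp add: bij_betw_def)
    ultimately show ?thesis using E unfolding K23_copies_def by blast
  qed
qed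

text \<open>The abstract construction wants three vertices on its second side; if only
  \<open>A\<close> is known to be that large, it is applied to the transposed edge map.\<close>

lemma seq_covers_complete_bipartite:
  assumes sub: "A \<subseteq> {..<m}" "B \<subseteq> {..<n}"
    and card: "2 \<le> card A" "2 \<le> card B" "3 \<le> card A \<or> 3 \<le> card B"
  obtains k where "seq_covers (K23_copies m n) (grid bedge A B) k"
    "k + card A + card B = card A * card B"
proof -
  have fin: "finite A" "finite B" using sub by (auto intro: finite_subset)
  have copy: "grid bedge A' B' \<in> K23_copies m n"
    if "A' \<subseteq> A" "B' \<subseteq> B" "card A' = 2 \<and> card B' = 3 \<or> card A' = 3 \<and> card B' = 2" for A' B'
    using that sub by (intro grid_mem_K23_copies) auto
  from card(3) show thesis
  proof
    assume B3: "3 \<le> card B"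
    show thesis
      by (rule seq_covers_grid[of bedge A B "K23_copies m n", OF bedge_inj _ _ fin card(1) B3]) (blast intro: copy that)+
  next
    assume A3: "3 \<le> card A"
    let ?r = "\<lambda>j i. bedge i j"
    obtain k where k: "seq_covers (K23_copies m n) (grid ?r B A) k"
      "k + card B + card A = card B * card A"
    proof (rule seq_covers_grid[of ?r B A "K23_copies m n"])
      show "grid ?r B' A' \<in> K23_copies m n"
        if "B' \<subseteq> B" "A' \<subseteq> A" "card B' = 3" "card A' = 2" for A' B'
        unfolding grid_swap[of bedge] using that copy by blast
      show "grid ?r B' A' \<in> K23_copies m n"
        if "B' \<subseteq> B" "A' \<subseteq> A" "card B' = 2" "card A' = 3" for A' B'
        unfolding grid_swap[of bedge] using that copy by blast
    qed (use fin card A3 in \<open>auto simp: doubleton_eq_iff\<close>)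
    show thesis
      by (rule that[of k]) (use k in \<open>simp_all add: grid_swap[of bedge] ac_simps\<close>)
  qed
qed

section \<open>Rank, value and maximality\<close>

lemma maximal_indep_val_le:
  assumes F: "F \<subseteq> K_edges m n" and IF: "I \<subseteq> F" and I: "I \<in> M_f10 m n"
    and max: "\<And>x. x \<in> F - I \<Longrightarrow> insert x I \<notin> M_f10 m n"
  obtains S where "proper_seq (K23_copies m n) S" "val F S \<le> int (card I)"
proof -
  have finF: "finite F" using F finite_K_edges by (rule finite_subset)
  obtain Z where Z: "Z \<subseteq> F" "card I = card (F - Z) + card (\<Union>Z)"
    using count_matroid_f10_maximal_card[OF finF _ F IF I max] F finite_K_edge by blast
  obtain A B where AB: "A \<subseteq> {..<m}" "B \<subseteq> {..<n}" "Z \<subseteq> grid bedge A B"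
    and cardZ: "card (\<Union>Z) = card A + card B"
    by (rule bipartite_sides[OF subset_trans[OF Z(1) F]])
  have finG: "finite (grid bedge A B)"
    using AB(1,2) unfolding grid_def by (auto intro: finite_subset)
  show thesis
  proof (cases "2 \<le> card A \<and> 2 \<le> card B \<and> (3 \<le> card A \<or> 3 \<le> card B)")
    case True
    then obtain k where k: "seq_covers (K23_copies m n) (grid bedge A B) k"
      "k + card A + card B = card A * card B"
      using seq_covers_complete_bipartite[OF AB(1,2)] by blast
    then obtain S where S: "proper_seq (K23_copies m n) S" "\<Union>(set S) = grid bedge A B" "length S = k"
      by (auto simp: seq_covers_def)
    \<comment> \<open>Replacing \<open>Z\<close> by the whole grid costs nothing: its |A||B| edges
      minus the |A||B| - |A| - |B| copies leave |A| + |B| = |V(Z)|.\<close>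
    have "card (F \<union> grid bedge A B) \<le> card ((F - Z) \<union> grid bedge A B)"
      using AB(3) finF finG by (intro card_mono) auto
    also have "\<dots> \<le> card (F - Z) + card A * card B"
      using card_Un_le[of "F - Z" "grid bedge A B"] by (simp add: card_grid_bedge)
    finally have "val F S \<le> int (card I)"
      using S k(2) Z(2) cardZ by (simp add: val_def)
    then show thesis using that S(1) by blast
  next
    case False
    \<comment> \<open>The grid is too small to contain a copy, so |Z| \<le> |V(Z)| and the empty
      sequence, of value |F|, suffices.\<close>
    then have "card A * card B \<le> card A + card B"
      by (intro mult_le_add_of_small) linarith
    moreover have "card Z \<le> card A * card B"
      using AB(3) finG by (metis card_grid_bedge card_mono)
    moreover have "card F = card (F - Z) + card Z"
      using Z(1) finF by (metis card_Diff_subset card_mono finite_subset le_add_diff_inverse2)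
    ultimately have "val F [] \<le> int (card I)"
      using Z(2) cardZ by (simp add: val_def)
    then show thesis using that proper_seq_Nil by blast
  qed
qed

theorem theorem4p4:
  fixes m n :: nat
  assumes "2 \<le> m" and "2 \<le> n" and "3 \<le> max m n"
  shows "maximal_K23_matroid m n (M_f10 m n)
       \<and> (\<forall>N. maximal_K23_matroid m n N \<longrightarrow> N = M_f10 m n)
       \<and> (\<forall>F. F \<subseteq> K_edges m n \<longrightarrow> val_K23 m n F = int (matroid_rank (M_f10 m n) F))"
proof -
  let ?E = "K_edges m n" and ?M = "M_f10 m n" and ?X = "K23_copies m n"
  have M: "matroid_on ?E ?M"
    using finite_K_edges finite_K_edge by (rule matroid_on_count_matroid_f10)
  then have K23: "K23_matroid m n ?M"
    using K23_copy_circuit by (simp add: K23_matroid_def)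
  have attained: "\<exists>I S. I \<subseteq> F \<and> I \<in> ?M \<and> proper_seq ?X S \<and> val F S \<le> int (card I)"
    if F: "F \<subseteq> ?E" for F
  proof -
    have "{} \<in> ?M" "finite F"
      using M F finite_K_edges by (auto simp: matroid_on_def intro: finite_subset)
    then obtain I where I: "I \<subseteq> F" "I \<in> ?M" "\<And>x. x \<in> F - I \<Longrightarrow> insert x I \<notin> ?M"
      using matroid_on_extend_maximal[OF M _ empty_subsetI] by metis
    obtain S where "proper_seq ?X S" "val F S \<le> int (card I)"
      by (rule maximal_indep_val_le[OF F I])
    then show ?thesis using I by blast
  qed
  have bound: "int (card J) \<le> val F S"
    if "K23_matroid m n N" "proper_seq ?X S" "J \<in> N" "J \<subseteq> F" "F \<subseteq> ?E" for N S J F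
    using that by (intro card_indep_le_val[of ?E N ?X]) (auto simp: K23_matroid_def)
  \<comment> \<open>Apply \<open>attained\<close> to the \<open>N\<close>-independent set
    \<open>J\<close> itself: |J| \<le> \<open>val J S\<close> \<le> |I| with
    \<open>I \<subseteq> J\<close> leaves only \<open>I = J\<close>. The count matroid is thus a
    largest element, which gives maximality and uniqueness at once.\<close>
  have largest: "weak_le N ?M" if N: "K23_matroid m n N" for N
    unfolding weak_le_def
  proof (intro allI impI)
    fix J assume J: "J \<in> N"
    then have JE: "J \<subseteq> ?E" using N by (auto simp: K23_matroid_def matroid_on_def)
    obtain I S where IS: "I \<subseteq> J" "I \<in> ?M" "proper_seq ?X S" "val J S \<le> int (card I)"
      using attained[OF JE] by metis
    have "int (card J) \<le> val J S" using bound[OF N IS(3) J _ JE] by simp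
    then have "card J \<le> card I" using IS(4) by linarith
    moreover have "finite J" using JE finite_K_edges by (rule finite_subset)
    ultimately have "I = J" using IS(1) by (meson card_seteq)
    then show "J \<in> ?M" using IS(2) by simp
  qed
  have "maximal_K23_matroid m n ?M"
    using K23 largest unfolding maximal_K23_matroid_def weak_le_def by blast
  moreover have "N = ?M" if "maximal_K23_matroid m n N" for N
    using that K23 largest unfolding maximal_K23_matroid_def by blast
  moreover have "val_K23 m n F = int (matroid_rank ?M F)" if F: "F \<subseteq> ?E" for F
  proof -
    obtain I S where IS: "I \<subseteq> F" "I \<in> ?M" "proper_seq ?X S" "val F S \<le> int (card I)"
      using attained[OF F] by metis
    have le: "int (card J) \<le> val F S'" if "proper_seq ?X S'" "J \<in> ?M" "J \<subseteq> F" for S' J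
      using bound[OF K23 that F] .
    \<comment> \<open>\<open>I\<close> and \<open>S\<close> certify each other: every value is at
      least |I|, and every independent subset of \<open>F\<close> has at most \<open>val F S\<close>
      elements. Both optima are therefore attained here.\<close>
    have eq: "val F S = int (card I)" using le[OF IS(3,2,1)] IS(4) by simp
    have "val_K23 m n F = val F S"
      unfolding val_min_def
    proof (rule Min_eqI)
      show "val F S \<in> {val F S |S. proper_seq ?X S}" using IS(3) by blast
    qed (use finite_val_K23_values IS(1,2) le[of _ I] eq in auto)
    moreover have "matroid_rank ?M F = card I"
      unfolding matroid_rank_def
    proof (rule Max_eqI)
      have "finite F" using F finite_K_edges by (rule finite_subset)
      then show "finite {card A |A. A \<subseteq> F \<and> A \<in> ?M}" by simp
    qed (use IS le[OF IS(3)] eq in auto)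
    ultimately show ?thesis using eq by simp
  qed
  ultimately show ?thesis by blast
qed

end
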